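(* Let $G$ be a graph. Then $G$ is a $D(3)$ graph if and only if $G\in\mathcal{D}(3)$, where $\mathcal{D}(3)$ is the class of graphs constructed in the context. In particular, there is no planar $D(3)$ graph.
   Context: All graphs are simple and connected. $\gamma(G)$ denotes the domination number and $\chi(G)$ the chromatic number of $G$. A coloring of $G$ with $k$ colors is a partition $C=(V_1,\dots,V_k)$ of $V(G)$ into independent sets, called color classes. A dominator coloring of $G$ is a coloring in which every vertex either is the only vertex of its own color class or is adjacent to every vertex of some color class; the dominator chromatic number $\chi_d(G)$ is the minimum number of colors in a dominator coloring of $G$. A graph $G$ is called a $D(k)$ graph if $\gamma(G)=\chi(G)=\chi_d(G)=k$. The class $\mathcal{D}(3)$: Let $V_1,V_2,V_3$ be three independent sets with $|V_1|\ge 3$, $|V_2|\ge 3$ and $|V_3|=1$. For $1\le i\le 3$, let $x_i\in V_i$, and let vertices $y_1,y_2,y_3$ be such that $x_i$ is adjacent to $y_j$ if and only if $i=j$. Further, let $y_1,y_3\in V_2$ and $y_2\in V_1$. A graph in the class $\mathcal{D}(3)$ is obtained from $V_1,V_2,V_3$ by adding edges as follows. (a) Join $y_1$ to every vertex in $V_1$ and join $y_2$ to every vertex in $V_2$. (b) Join $x_1$ to $x_3$ and join $x_1$ to some (or all) of the vertices of $V_2\setminus\{y_3\}$. (c) Join $y_3$ to some (or all) of the vertices of $V_1\setminus\{x_1\}$. (d) Join each vertex in $V_1\setminus\{x_1,y_2\}$ to every vertex in $V_2$ or $V_3$ (but not both), and join each vertex in $V_2\setminus\{y_3,y_1\}$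 to every vertex in $V_1$ or $V_3$ (but not both), in such a way that $x_3$ has at least two non-neighbors in both $V_1$ and $V_2$. (e) For all $x\in V_1$, $y\in V_2$ such that $xy\notin E(G)$, either $x$ has at least one non-neighbor other than $y$ in $V_2$ or $y$ has at least one non-neighbor other than $x$ in $V_1$. *)

theory Defs
  imports "HOL-Analysis.Analysis"
begin

(* A graph is given by its vertex set V and its edge set E, the edges being two-element
   subsets of V. In particular "{v, v}" is never an edge. *)

definition simple_graph :: "'a set \<Rightarrow> 'a set set \<Rightarrow> bool" where
  "simple_graph V E \<longleftrightarrow>
     finite V \<and> V \<noteq> {} \<and> (\<forall>e\<in>E. \<exists>u\<in>V. \<exists>v\<in>V. u \<noteq> v \<and> e = {u, v})"

definition connected_graph :: "'a set \<Rightarrow> 'a set set \<Rightarrow> bool" where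
  "connected_graph V E \<longleftrightarrow> (\<forall>u\<in>V. \<forall>v\<in>V. (u, v) \<in> {(x, y). {x, y} \<in> E}\<^sup>*)"

definition dominating_set :: "'a set \<Rightarrow> 'a set set \<Rightarrow> 'a set \<Rightarrow> bool" where
  "dominating_set V E S \<longleftrightarrow> S \<subseteq> V \<and> (\<forall>v\<in>V - S. \<exists>u\<in>S. {u, v} \<in> E)"

definition domination_number :: "'a set \<Rightarrow> 'a set set \<Rightarrow> nat" where
  "domination_number V E = (LEAST k. \<exists>S. dominating_set V E S \<and> card S = k)"

definition independent_set :: "'a set \<Rightarrow> 'a set set \<Rightarrow> 'a set \<Rightarrow> bool" where
  "independent_set V E S \<longleftrightarrow> S \<subseteq> V \<and> (\<forall>u\<in>S. \<forall>v\<in>S. {u, v} \<notin> E)"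

(* The color classes of a coloring are nonempty, as is required by "partition_on". *)

definition coloring :: "'a set \<Rightarrow> 'a set set \<Rightarrow> 'a set set \<Rightarrow> bool" where
  "coloring V E C \<longleftrightarrow> partition_on V C \<and> (\<forall>A\<in>C. independent_set V E A)"

definition chromatic_number :: "'a set \<Rightarrow> 'a set set \<Rightarrow> nat" where
  "chromatic_number V E = (LEAST k. \<exists>C. coloring V E C \<and> card C = k)"

definition dominator_coloring :: "'a set \<Rightarrow> 'a set set \<Rightarrow> 'a set set \<Rightarrow> bool" where
  "dominator_coloring V E C \<longleftrightarrow>
     coloring V E C \<and> (\<forall>v\<in>V. {v} \<in> C \<or> (\<exists>A\<in>C. \<forall>u\<in>A. {v, u} \<in> E))"

definition dominator_chromatic_number :: "'a set \<Rightarrow> 'a set set \<Rightarrow> nat" where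
  "dominator_chromatic_number V E = (LEAST k. \<exists>C. dominator_coloring V E C \<and> card C = k)"

definition D_graph :: "nat \<Rightarrow> 'a set \<Rightarrow> 'a set set \<Rightarrow> bool" where
  "D_graph k V E \<longleftrightarrow>
     domination_number V E = k \<and> chromatic_number V E = k \<and> dominator_chromatic_number V E = k"

(* The class of graphs is obtained by a construction that adds edges between V1, V2 and V3; each
   of its steps is read as a condition on the finished edge set. Inequality of truth values renders
   "join v to every vertex in V2 or V3, but not both". It does not prevent a vertex of V1 joined
   to V3 from being joined to some, but not all, vertices of V2 (and likewise with V1 and V2
   exchanged). *)

definition class_D3 :: "'a set \<Rightarrow> 'a set set \<Rightarrow> bool" where
  "class_D3 V E \<longleftrightarrow>
     (\<exists>V1 V2 V3 x1 x2 x3 y1 y2 y3.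
        V = V1 \<union> V2 \<union> V3 \<and> V1 \<inter> V2 = {} \<and> V1 \<inter> V3 = {} \<and> V2 \<inter> V3 = {} \<and>
        independent_set V E V1 \<and> independent_set V E V2 \<and> independent_set V E V3 \<and>
        card V1 \<ge> 3 \<and> card V2 \<ge> 3 \<and> card V3 = 1 \<and>
        x1 \<in> V1 \<and> x2 \<in> V2 \<and> x3 \<in> V3 \<and> y1 \<in> V2 \<and> y2 \<in> V1 \<and> y3 \<in> V2 \<and>
        {x1, y1} \<in> E \<and> {x1, y2} \<notin> E \<and> {x1, y3} \<notin> E \<and>
        {x2, y1} \<notin> E \<and> {x2, y2} \<in> E \<and> {x2, y3} \<notin> E \<and>
        {x3, y1} \<notin> E \<and> {x3, y2} \<notin> E \<and> {x3, y3} \<in> E \<and>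
        (\<forall>v\<in>V1. {y1, v} \<in> E) \<and> (\<forall>w\<in>V2. {y2, w} \<in> E) \<and>
        {x1, x3} \<in> E \<and> (\<exists>w\<in>V2 - {y3}. {x1, w} \<in> E) \<and>
        (\<exists>v\<in>V1 - {x1}. {y3, v} \<in> E) \<and>
        (\<forall>v\<in>V1 - {x1, y2}. (\<forall>w\<in>V2. {v, w} \<in> E) \<noteq> (\<forall>z\<in>V3. {v, z} \<in> E)) \<and>
        (\<forall>w\<in>V2 - {y3, y1}. (\<forall>v\<in>V1. {w, v} \<in> E) \<noteq> (\<forall>z\<in>V3. {w, z} \<in> E)) \<and>
        card {v \<in> V1. {x3, v} \<notin> E} \<ge> 2 \<and> card {w \<in> V2. {x3, w} \<notin> E} \<ge> 2 \<and>
        (\<forall>x\<in>V1. \<forall>y\<in>V2. {x, y} \<notin> E \<longrightarrow>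
           (\<exists>w\<in>V2 - {y}. {x, w} \<notin> E) \<or> (\<exists>v\<in>V1 - {x}. {y, v} \<notin> E)))"

(* A planar drawing: vertices are distinct points of the plane (identified with the complex
   numbers), every edge is an arc between its ends that avoids all other vertices, and two
   different edges meet at most in a common end. *)

definition planar_graph :: "'a set \<Rightarrow> 'a set set \<Rightarrow> bool" where
  "planar_graph V E \<longleftrightarrow>
     (\<exists>(p :: 'a \<Rightarrow> complex) (g :: 'a set \<Rightarrow> real \<Rightarrow> complex).
        inj_on p V \<and>
        (\<forall>e\<in>E. arc (g e) \<and> {pathstart (g e), pathfinish (g e)} = p ` e \<and>
               path_image (g e) \<inter> p ` V = p ` e) \<and>
        (\<forall>e\<in>E. \<forall>f\<in>E. e \<noteq> f \<longrightarrow> path_image (g e) \<inter> path_image (g f) = p ` (e \<inter> f)))"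

end

theory Submission
  imports Defs
begin

text \<open>
  In a coloring that witnesses \<open>\<chi>\<^sub>d = 3\<close>, exactly one class is a singleton \<open>{x\<^sub>3}\<close>: with none, or with
  two, some two vertices would dominate the graph. Hence every vertex of the other classes
  \<open>V\<^sub>1\<close>, \<open>V\<^sub>2\<close> is joined to all of the opposite class or to \<open>x\<^sub>3\<close>, and conditions (a)-(e) merely say
  that no two vertices dominate. Conversely the 5-cycle \<open>x\<^sub>1 x\<^sub>3 y\<^sub>3 y\<^sub>2 y\<^sub>1\<close> forces three colors.

  If \<open>a\<^sub>1, a\<^sub>2 \<in> V\<^sub>1\<close> and \<open>b\<^sub>1, b\<^sub>2 \<in> V\<^sub>2\<close> are non-neighbors of \<open>x\<^sub>3\<close>, then \<open>{a\<^sub>1, a\<^sub>2, x\<^sub>1}\<close> and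
  \<open>{b\<^sub>1, b\<^sub>2, y\<^sub>3}\<close> span a \<open>K\<^sub>3\<^sub>,\<^sub>3\<close> whose edge \<open>x\<^sub>1 y\<^sub>3\<close> is subdivided by \<open>x\<^sub>3\<close>. In a planar drawing of
  \<open>K\<^sub>3\<^sub>,\<^sub>3\<close> the edges form a hexagon, which is a Jordan curve, and three pairwise crossing chords, of
  which two lie on the same side. Two crossing chords inside contradict the theta-curve theorem; an
  inversion centered inside the hexagon reduces the other case to this one.
\<close>

subsection \<open>Crossing arcs on one side of a Jordan curve\<close>

text \<open>Arcs are handled as point sets with two named ends, so that gluing and crossing become
  set equations and the parametrization with its direction disappears.\<close>

definition arc_joins :: "complex set \<Rightarrow> complex \<Rightarrow> complex \<Rightarrow> bool" where
  "arc_joins S a b \<longleftrightarrow> (\<exists>g. arc g \<and> path_image g = S \<and> pathstart g = a \<and> pathfinish g = b)"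

lemma arc_joins_commute: "arc_joins S a b \<Longrightarrow> arc_joins S b a"
  unfolding arc_joins_def
  by (metis arc_reversepath path_image_reversepath pathfinish_reversepath pathstart_reversepath)

lemma arc_joins_distinct: "arc_joins S a b \<Longrightarrow> a \<noteq> b"
  unfolding arc_joins_def using arc_distinct_ends by fastforce

lemma arc_joins_compact: "arc_joins S a b \<Longrightarrow> compact S"
  unfolding arc_joins_def using arc_imp_path compact_path_image by blast

lemma arc_joins_Un:
  assumes "arc_joins S a b" "arc_joins T b c" "S \<inter> T = {b}"
  shows "arc_joins (S \<union> T) a c"
proof -
  obtain g h where "arc g" "path_image g = S" "pathstart g = a" "pathfinish g = b"
    "arc h" "path_image h = T" "pathstart h = b" "pathfinish h = c"
    using assms unfolding arc_joins_def by blast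
  then show ?thesis
    unfolding arc_joins_def using assms(3)
    by (intro exI[of _ "g +++ h"]) (simp add: arc_join_eq path_image_join)
qed

lemma arc_joins_image:
  assumes "arc_joins S a b" "continuous_on S f" "inj_on f S"
  shows "arc_joins (f ` S) (f a) (f b)"
proof -
  obtain g where g: "arc g" "path_image g = S" "pathstart g = a" "pathfinish g = b"
    using assms unfolding arc_joins_def by blast
  have "arc (f \<circ> g)"
    using g assms unfolding arc_def path_image_def
    by (auto simp: path_image_def intro: path_continuous_image comp_inj_on)
  with g show ?thesis
    unfolding arc_joins_def by (auto simp: path_image_compose pathstart_compose pathfinish_compose)
qed

text \<open>The closure statement carries information from the interior of an arc to its ends: if
  the interior lies in a region, the ends lie in the closure of that region.\<close>

lemma arc_joins_interior:
  assumes "arc_joins S a b"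
  shows "connected (S - {a, b})" "closure (S - {a, b}) = S" "S - {a, b} \<noteq> {}"
proof -
  obtain g where g: "arc g" "path_image g = S" "pathstart g = a" "pathfinish g = b"
    using assms unfolding arc_joins_def by blast
  show "connected (S - {a, b})"
    using connected_simple_path_endless[OF arc_imp_simple_path[OF g(1)]] g by simp
  have eq: "S - {a, b} = g ` {0<..<1}"
    using simple_path_endless[OF arc_imp_simple_path[OF g(1)]] g by simp
  then show "S - {a, b} \<noteq> {}" by simp
  have "continuous_on (closure {0<..<1}) g"
    using g(1) by (simp add: arc_def path_def)
  then have "g ` closure {0<..<1} \<subseteq> closure (S - {a, b})"
    unfolding eq by (intro image_closure_subset) (auto simp: closure_subset)
  moreover have "closure (S - {a, b}) \<subseteq> S"
    using arc_joins_compact[OF assms] by (simp add: closure_minimal compact_imp_closed)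
  ultimately show "closure (S - {a, b}) = S"
    using g(2) by (auto simp: path_image_def)
qed

lemma connected_subset_disjoint_open:
  assumes "connected S" "open A" "open B" "A \<inter> B = {}" "S \<subseteq> A \<union> B"
  shows "S \<subseteq> A \<or> S \<subseteq> B"
proof -
  have "A \<inter> S = {} \<or> B \<inter> S = {}"
    using assms by (intro connectedD) auto
  then show ?thesis using assms(5) by blast
qed

lemma arc_joins_inside_or_outside:
  assumes "arc_joins S a b" "S \<inter> H = {a, b}" "closed H"
  shows "S - {a, b} \<subseteq> inside H \<or> S - {a, b} \<subseteq> outside H"
proof -
  have "S - {a, b} \<subseteq> inside H \<union> outside H" using assms(2) by auto
  with arc_joins_interior(1)[OF assms(1)] show ?thesis
    using assms(3) by (intro connected_subset_disjoint_open open_inside open_outside inside_Int_outside)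
qed

text \<open>By the theta-curve theorem, \<open>C\<close> cuts the inside of the Jordan curve
  \<open>C1 \<union> C2\<close> into the insides of \<open>C1 \<union> C\<close> and
  \<open>C2 \<union> C\<close>. The interior of \<open>D\<close> is connected and misses
  \<open>C\<close>, so it stays in one of these; but \<open>D\<close> has one end on
  \<open>C1\<close> and one on \<open>C2\<close>, neither on \<open>C\<close>, and one of them is
  out of reach.\<close>

lemma crossing_arcs_not_inside:
  assumes c1: "arc_joins C1 a b" and c2: "arc_joins C2 a b"
    and c: "arc_joins C a b" and d: "arc_joins D u v"
    and "C1 \<inter> C2 = {a, b}" "C1 \<inter> C = {a, b}" "C2 \<inter> C = {a, b}"
    and "C \<inter> D = {}" "C1 \<inter> D = {u}" "C2 \<inter> D = {v}"
    and C_in: "C - {a, b} \<subseteq> inside (C1 \<union> C2)" and D_in: "D - {u, v} \<subseteq> inside (C1 \<union> C2)"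
  shows False
proof -
  have closed: "closed C1" "closed C2" "closed C"
    using c1 c2 c arc_joins_compact compact_imp_closed by blast+
  have ne: "C \<inter> inside (C1 \<union> C2) \<noteq> {}"
    using arc_joins_interior(3)[OF c] C_in by blast
  have split: "inside (C1 \<union> C) \<inter> inside (C2 \<union> C) = {}"
    "inside (C1 \<union> C) \<union> inside (C2 \<union> C) \<union> (C - {a, b}) = inside (C1 \<union> C2)"
  proof -
    obtain f f1 f2 where
      "arc f" "path_image f = C" "pathstart f = a" "pathfinish f = b"
      "arc f1" "path_image f1 = C1" "pathstart f1 = a" "pathfinish f1 = b"
      "arc f2" "path_image f2 = C2" "pathstart f2 = a" "pathfinish f2 = b"
      using c c1 c2 unfolding arc_joins_def by blast
    with split_inside_simple_closed_curve[of f1 a b f2 f] arc_joins_distinct[OF c] assms(5-7) ne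
    show "inside (C1 \<union> C) \<inter> inside (C2 \<union> C) = {}"
      "inside (C1 \<union> C) \<union> inside (C2 \<union> C) \<union> (C - {a, b}) = inside (C1 \<union> C2)"
      by (metis arc_imp_simple_path)+
  qed
  \<comment> \<open>\<open>w\<close> stands for the end of \<open>D\<close> that is not on
    \<open>X\<close>. As a limit of points inside \<open>X \<union> C\<close> it would lie in
    \<open>X\<close>, in \<open>C\<close> or inside, and each is excluded.\<close>
  have no: False if "D - {u, v} \<subseteq> inside (X \<union> C)" "w \<in> D" "w \<in> C1 \<union> C2" "w \<notin> X"
      "closed X" "inside (X \<union> C) \<subseteq> inside (C1 \<union> C2)" for X w
  proof -
    have "w \<in> closure (inside (X \<union> C))"
      using closure_mono[OF that(1)] arc_joins_interior(2)[OF d] that(2) by auto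
    then have "w \<in> X \<union> C \<union> inside (X \<union> C)"
      using closure_inside_subset[of "X \<union> C"] closed that(5) by blast
    moreover have "w \<notin> inside (C1 \<union> C2)"
      using that(3) inside_no_overlap by blast
    ultimately show False
      using that assms(8) by blast
  qed
  have "D - {u, v} \<subseteq> inside (C1 \<union> C) \<union> inside (C2 \<union> C)"
    using D_in split(2) assms(8) by blast
  moreover have "open (inside (C1 \<union> C))" "open (inside (C2 \<union> C))"
    using closed by (auto intro!: open_inside)
  ultimately have "D - {u, v} \<subseteq> inside (C1 \<union> C) \<or> D - {u, v} \<subseteq> inside (C2 \<union> C)"
    using arc_joins_interior(1)[OF d] split(1) by (intro connected_subset_disjoint_open)
  moreover have sub: "inside (C1 \<union> C) \<subseteq> inside (C1 \<union> C2)" "inside (C2 \<union> C) \<subseteq> inside (C1 \<union> C2)"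
    using split(2) by blast+
  moreover have u: "u \<in> C1" "u \<in> D" and v: "v \<in> C2" "v \<in> D"
    using assms(9,10) by auto
  moreover have "u \<notin> C" "v \<notin> C"
    using assms(8) u v by auto
  then have "u \<notin> C2" "v \<notin> C1"
    using assms(5,6) u v by blast+
  ultimately show False
  proof (elim disjE)
    assume "D - {u, v} \<subseteq> inside (C1 \<union> C)"
    then show False using no[of C1 v] v \<open>v \<notin> C1\<close> closed(1) sub(1) by blast
  next
    assume "D - {u, v} \<subseteq> inside (C2 \<union> C)"
    then show False using no[of C2 u] u \<open>u \<notin> C2\<close> closed(2) sub(2) by blast
  qed
qed

section \<open>Inversion: moving the outside of a curve to the inside\<close>

text \<open>Since \<open>inverse 0 = 0\<close>, the map sends \<open>p\<close> to 0 and is injective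
  on the whole plane; continuity fails only at \<open>p\<close>.\<close>

definition inversion :: "complex \<Rightarrow> complex \<Rightarrow> complex" where
  "inversion p z = inverse (z - p)"

lemma inj_inversion: "inj (inversion p)"
  by (auto simp: inversion_def inj_def)

lemma continuous_on_inversion: "p \<notin> S \<Longrightarrow> continuous_on S (inversion p)"
  unfolding inversion_def by (intro continuous_intros) auto

text \<open>The outside of the image curve, without 0, is connected, and its preimage avoids
  \<open>H\<close> and comes arbitrarily close to \<open>p\<close>. So the preimage lies inside
  \<open>H\<close>, and no point outside \<open>H\<close> can be mapped to the outside of the image
  curve.\<close>

lemma inversion_outside_subset_inside:
  assumes p: "p \<in> inside H" and "compact H"
  shows "inversion p ` outside H \<subseteq> inside (inversion p ` H)"
proof -
  let ?f = "inversion p" and ?g = "\<lambda>w. p + inverse w"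
  have gf: "?g (?f z) = z" for z by (simp add: inversion_def)
  have fg: "?f (?g z) = z" for z by (simp add: inversion_def)
  have "p \<notin> H" using p inside_no_overlap by blast
  then have comp: "compact (?f ` H)"
    using assms(2) by (intro compact_continuous_image continuous_on_inversion)
  then have opn: "open (outside (?f ` H))"
    by (simp add: open_outside compact_imp_closed)
  \<comment> \<open>The point 0 corresponds to infinity under \<open>?g\<close>, which is continuous
    everywhere else. Deleting one point from an open connected subset of the plane keeps it
    connected.\<close>
  let ?U = "outside (?f ` H) - {0}"
  have conn: "connected ?U"
    using opn comp connected_outside[of "?f ` H"] connected_open_delete[OF opn]
    by (simp add: compact_imp_bounded)
  have "continuous_on ?U ?g" by (intro continuous_intros) auto
  then have conng: "connected (?g ` ?U)" using conn connected_continuous_image by blast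
  have disj: "?g ` ?U \<subseteq> - H"
  proof
    fix z assume "z \<in> ?g ` ?U"
    then obtain w where "w \<in> outside (?f ` H)" "z = ?g w" by blast
    then show "z \<in> - H"
      using fg[of w] outside_no_overlap[of "?f ` H"] by (metis ComplI IntI empty_iff imageI)
  qed
  obtain e where e: "e > 0" "ball p e \<subseteq> inside H"
    using p assms(2) open_inside[of H] open_contains_ball compact_imp_closed by metis
  \<comment> \<open>A point \<open>w\<close> this far out has its preimage \<open>?g w\<close> at
    distance \<open>1 / norm w < e\<close> from \<open>p\<close>, hence inside
    \<open>H\<close>.\<close>
  have "\<not> bounded (outside (?f ` H))"
    using comp by (simp add: unbounded_outside compact_imp_bounded)
  then obtain w where w: "w \<in> outside (?f ` H)" "norm w > 1 / e"
    unfolding bounded_iff by (meson not_le)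
  have "norm w > 0" using w(2) e(1) by (smt (verit) divide_pos_pos)
  then have "w \<in> ?U" using w by auto
  moreover have "?g w \<in> ball p e"
    using w(2) e(1) \<open>norm w > 0\<close> by (simp add: dist_norm norm_inverse norm_divide field_simps)
  ultimately have meets: "?g ` ?U \<inter> inside H \<noteq> {}" using e(2) by blast
  have "?g ` ?U \<subseteq> inside H"
  proof -
    have "?g ` ?U \<subseteq> inside H \<or> ?g ` ?U \<subseteq> outside H"
      using conng assms(2) disj
      by (intro connected_subset_disjoint_open open_inside open_outside) (auto simp: compact_imp_closed)
    then show ?thesis using meets inside_Int_outside[of H] by blast
  qed
  show ?thesis
  proof
    fix y assume "y \<in> ?f ` outside H"
    then obtain z where z: "z \<in> outside H" "y = ?f z" by blast
    have "z \<noteq> p" using z p inside_Int_outside by blast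
    then have "y \<noteq> 0" using z by (simp add: inversion_def)
    moreover have "z \<notin> inside H" using z inside_Int_outside by blast
    ultimately have "y \<notin> outside (?f ` H)"
      using \<open>?g ` ?U \<subseteq> inside H\<close> gf z(2) by force
    moreover have "y \<notin> ?f ` H"
      using z inj_inversion outside_no_overlap by (metis IntI empty_iff inj_image_mem_iff)
    ultimately show "y \<in> inside (?f ` H)" by (simp add: inside_outside)
  qed
qed

text \<open>An inversion centered at a point inside \<open>C1 \<union> C2\<close>, which exists by
  the Jordan curve theorem, moves the interiors of \<open>C\<close> and \<open>D\<close> inside the
  image curve. Injectivity preserves all intersections, so the inside case applies.\<close>

lemma crossing_arcs_not_outside:
  assumes c1: "arc_joins C1 a b" and c2: "arc_joins C2 a b"
    and c: "arc_joins C a b" and d: "arc_joins D u v"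
    and ints: "C1 \<inter> C2 = {a, b}" "C1 \<inter> C = {a, b}" "C2 \<inter> C = {a, b}"
      "C \<inter> D = {}" "C1 \<inter> D = {u}" "C2 \<inter> D = {v}"
    and C_out: "C - {a, b} \<subseteq> outside (C1 \<union> C2)" and D_out: "D - {u, v} \<subseteq> outside (C1 \<union> C2)"
  shows False
proof -
  let ?H = "C1 \<union> C2"
  have "inside ?H \<noteq> {}"
  proof -
    obtain f1 f2 where f:
      "arc f1" "path_image f1 = C1" "pathstart f1 = a" "pathfinish f1 = b"
      "arc f2" "path_image f2 = C2" "pathstart f2 = a" "pathfinish f2 = b"
      using c1 c2 unfolding arc_joins_def by blast
    then have "simple_path (f1 +++ reversepath f2)"
      using ints(1) by (simp add: simple_path_join_loop arc_reversepath)
    moreover have "path_image (f1 +++ reversepath f2) = ?H"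
      using f by (simp add: path_image_join)
    ultimately show ?thesis
      using Jordan_inside_outside[of "f1 +++ reversepath f2"] f by simp
  qed
  then obtain p where p: "p \<in> inside ?H" by blast
  let ?f = "inversion p"
  have cH: "compact ?H" using c1 c2 arc_joins_compact by blast
  \<comment> \<open>The interiors of \<open>C\<close> and \<open>D\<close> are outside the curve and
    their ends are on it, so the center is on none of the four arcs and the inversion is continuous
    on them.\<close>
  have "p \<notin> ?H" "p \<notin> outside ?H"
    using p inside_no_overlap inside_Int_outside by blast+
  moreover have "{a, b} \<subseteq> ?H" "{u, v} \<subseteq> ?H"
    using ints by auto
  ultimately have pn: "p \<notin> C1" "p \<notin> C2" "p \<notin> C" "p \<notin> D"
    using C_out D_out by auto
  have img: "arc_joins (?f ` S) (?f s) (?f t)" if "arc_joins S s t" "p \<notin> S" for S s t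
    using that by (intro arc_joins_image continuous_on_inversion)
      (auto intro: inj_on_subset[OF inj_inversion])
  have int: "?f ` S \<inter> ?f ` T = ?f ` (S \<inter> T)" for S T
    by (simp add: image_Int inj_inversion)
  have diff: "?f ` S - ?f ` T = ?f ` (S - T)" for S T
    by (simp add: image_set_diff inj_inversion)
  have sub: "?f ` outside ?H \<subseteq> inside (?f ` C1 \<union> ?f ` C2)"
    using inversion_outside_subset_inside[OF p cH] by (simp add: image_Un)
  show False
  proof (rule crossing_arcs_not_inside[of "?f ` C1" "?f a" "?f b" "?f ` C2" "?f ` C" "?f ` D" "?f u" "?f v"])
    show "?f ` C - {?f a, ?f b} \<subseteq> inside (?f ` C1 \<union> ?f ` C2)"
      using diff[of C "{a,b}"] C_out sub by auto
    show "?f ` D - {?f u, ?f v} \<subseteq> inside (?f ` C1 \<union> ?f ` C2)"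
      using diff[of D "{u,v}"] D_out sub by auto
  qed (use img c1 c2 c d pn ints in \<open>simp_all add: int\<close>)
qed

subsection \<open>Non-planarity of \<open>K\<^sub>3\<^sub>,\<^sub>3\<close>\<close>

text \<open>Edges are arbitrary arcs here, so that a subdivided edge can enter as a single arc. Any
  two of the three chords \<open>S i i\<close> lie on different sides of the hexagon, which is
  impossible with only two sides.\<close>

lemma K33_not_planar:
  fixes S :: "nat \<Rightarrow> nat \<Rightarrow> complex set"
  assumes joins: "\<And>i j. i < 3 \<Longrightarrow> j < 3 \<Longrightarrow> arc_joins (S i j) (p i) (q j)"
    and row: "\<And>i j l. i < 3 \<Longrightarrow> j < 3 \<Longrightarrow> l < 3 \<Longrightarrow> j \<noteq> l \<Longrightarrow> S i j \<inter> S i l = {p i}"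
    and column: "\<And>i j k. i < 3 \<Longrightarrow> j < 3 \<Longrightarrow> k < 3 \<Longrightarrow> i \<noteq> k \<Longrightarrow> S i j \<inter> S k j = {q j}"
    and disj: "\<And>i j k l. i < 3 \<Longrightarrow> j < 3 \<Longrightarrow> k < 3 \<Longrightarrow> l < 3 \<Longrightarrow> i \<noteq> k \<Longrightarrow> j \<noteq> l
      \<Longrightarrow> S i j \<inter> S k l = {}"
  shows False
proof -
  \<comment> \<open>\<open>H\<close> is the hexagon formed by the edges \<open>S i j\<close> with \<open>i \<noteq> j\<close>; the chords are the \<open>S i i\<close>.\<close>
  define H where "H = S 0 1 \<union> S 0 2 \<union> S 1 0 \<union> S 1 2 \<union> S 2 0 \<union> S 2 1"
  define ins where "ins i \<longleftrightarrow> S i i - {p i, q i} \<subseteq> inside H" for i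
  define outs where "outs i \<longleftrightarrow> S i i - {p i, q i} \<subseteq> outside H" for i
  \<comment> \<open>This is the half \<open>p i\<close>, \<open>q k\<close>, \<open>p m\<close>,
    \<open>q i\<close> of the hexagon, between the ends of the chord \<open>S i i\<close>;
    exchanging \<open>k\<close> and \<open>m\<close> gives the other half.\<close>
  have half: "arc_joins (S i k \<union> S m k \<union> S m i) (p i) (q i)"
    if lt: "i < 3" "k < 3" "m < 3" and ne: "i \<noteq> k" "i \<noteq> m" "k \<noteq> m" for i k m
  proof -
    have "arc_joins (S i k \<union> S m k) (p i) (p m)"
      using joins[OF lt(1,2)] arc_joins_commute[OF joins[OF lt(3,2)]] column[OF lt(1,2,3) ne(2)]
      by (rule arc_joins_Un)
    moreover have "(S i k \<union> S m k) \<inter> S m i = {p m}"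
      using lt ne row[of m k i] disj[of i k m i] by (simp add: Int_Un_distrib2)
    ultimately show ?thesis
      using arc_joins_Un joins[OF lt(3,1)] by blast
  qed
  have opposite: "\<not> (ins i \<and> ins k)" "\<not> (outs i \<and> outs k)"
    if lt: "i < 3" "k < 3" "m < 3" and ne: "i \<noteq> k" "i \<noteq> m" "k \<noteq> m" for i k m
  proof -
    \<comment> \<open>The chord \<open>S k k\<close> crosses \<open>S i i\<close> because
      \<open>q k\<close> lies on the first half and \<open>p k\<close> on the second. This order of
      its ends is why the chord is reversed in \<open>args\<close>.\<close>
    let ?C1 = "S i k \<union> S m k \<union> S m i" and ?C2 = "S i m \<union> S k m \<union> S k i"
    have "i \<in> {0, 1, 2}" "k \<in> {0, 1, 2}" "m \<in> {0, 1, 2}" using lt by auto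
    then have H: "?C1 \<union> ?C2 = H"
      using ne unfolding H_def by (elim insertE emptyE) (simp_all add: Un_ac)
    have c2: "arc_joins ?C2 (p i) (q i)"
      using half[of i m k] lt ne by simp
    note simps = Int_Un_distrib Int_Un_distrib2 row column disj lt ne ne[symmetric]
    have ints: "?C1 \<inter> ?C2 = {p i, q i}" "?C1 \<inter> S i i = {p i, q i}" "?C2 \<inter> S i i = {p i, q i}"
      "S i i \<inter> S k k = {}" "?C1 \<inter> S k k = {q k}" "?C2 \<inter> S k k = {p k}"
      by (simp_all add: simps insert_commute)
    note args = half[OF lt ne] c2 joins[OF lt(1,1)] arc_joins_commute[OF joins[OF lt(2,2)]] ints
    show "\<not> (ins i \<and> ins k)"
    proof
      assume "ins i \<and> ins k"
      then have "S i i - {p i, q i} \<subseteq> inside H" "S k k - {q k, p k} \<subseteq> inside H"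
        by (simp_all add: ins_def insert_commute)
      then show False using crossing_arcs_not_inside[OF args] H by simp
    qed
    show "\<not> (outs i \<and> outs k)"
    proof
      assume "outs i \<and> outs k"
      then have "S i i - {p i, q i} \<subseteq> outside H" "S k k - {q k, p k} \<subseteq> outside H"
        by (simp_all add: outs_def insert_commute)
      then show False using crossing_arcs_not_outside[OF args] H by simp
    qed
  qed
  have "closed (S i j)" if "i < 3" "j < 3" for i j
    using joins[OF that] arc_joins_compact compact_imp_closed by blast
  then have closed: "closed H"
    unfolding H_def by (intro closed_Un) simp_all
  have side: "ins i \<or> outs i" if "i \<in> {0, 1, 2}" for i
  proof -
    have "S i i \<inter> H = {p i, q i}"
      using that unfolding H_def
      by (elim insertE emptyE) (simp_all add: Int_Un_distrib row column disj insert_commute)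
    moreover have "i < 3" using that by auto
    ultimately show ?thesis
      using arc_joins_inside_or_outside[OF joins[of i i] _ closed]
      unfolding ins_def outs_def by blast
  qed
  show False
    using side[of 0] side[of 1] side[of 2] opposite[of 0 1 2] opposite[of 0 2 1] opposite[of 1 2 0]
    by auto
qed

section \<open>From planar drawings to arcs\<close>

text \<open>The drawn edges from \<open>u 2\<close> to \<open>z\<close> and from \<open>z\<close> to
  \<open>w 2\<close> meet only in the point of \<open>z\<close>, so their union is an arc that plays
  the missing edge of a \<open>K_{3,3}\<close>.\<close>

lemma planar_graph_subdivided_K33:
  fixes u w :: "nat \<Rightarrow> 'a"
  assumes planar: "planar_graph V E"
    and u: "inj_on u {..<3}" and w: "inj_on w {..<3}"
    and uw: "\<And>i j. i < 3 \<Longrightarrow> j < 3 \<Longrightarrow> u i \<noteq> w j"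
    and z: "\<And>i. i < 3 \<Longrightarrow> u i \<noteq> z" "\<And>j. j < 3 \<Longrightarrow> w j \<noteq> z"
    and edges: "\<And>i j. i < 3 \<Longrightarrow> j < 3 \<Longrightarrow> i \<noteq> 2 \<or> j \<noteq> 2 \<Longrightarrow> {u i, w j} \<in> E"
      "{u 2, z} \<in> E" "{z, w 2} \<in> E"
  shows False
proof -
  obtain p :: "'a \<Rightarrow> complex" and g :: "'a set \<Rightarrow> real \<Rightarrow> complex" where
    g: "\<forall>e\<in>E. arc (g e) \<and> {pathstart (g e), pathfinish (g e)} = p ` e \<and>
      path_image (g e) \<inter> p ` V = p ` e" and
    int: "\<forall>e\<in>E. \<forall>f\<in>E. e \<noteq> f \<longrightarrow> path_image (g e) \<inter> path_image (g f) = p ` (e \<inter> f)"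
    using planar unfolding planar_graph_def by blast
  define G where "G e = path_image (g e)" for e
  \<comment> \<open>A drawing fixes the ends of an edge only as a set; symmetry of
    \<open>arc_joins\<close> covers both directions.\<close>
  have G: "arc_joins (G {s, t}) (p s) (p t)" if "{s, t} \<in> E" for s t
  proof -
    have "arc_joins (G {s, t}) (pathstart (g {s, t})) (pathfinish (g {s, t}))"
      using bspec[OF g that] unfolding G_def arc_joins_def by auto
    moreover have "{pathstart (g {s, t}), pathfinish (g {s, t})} = {p s, p t}"
      using bspec[OF g that] by simp
    ultimately show ?thesis
      using arc_joins_commute by (auto simp: doubleton_eq_iff)
  qed
  have Gint: "G {s, t} \<inter> G {s', t'} = p ` ({s, t} \<inter> {s', t'})"
    if "{s, t} \<in> E" "{s', t'} \<in> E" "{s, t} \<noteq> {s', t'}" for s t s' t'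
    using int that by (simp add: G_def)
  have u_eq: "u i = u k \<longleftrightarrow> i = k" and w_eq: "w i = w k \<longleftrightarrow> i = k" if "i < 3" "k < 3" for i k
    using inj_on_eq_iff[OF u] inj_on_eq_iff[OF w] that by auto
  note neq = u_eq w_eq uw uw[symmetric] z z[symmetric]
  define S where "S i j = (if i = 2 \<and> j = 2 then G {u 2, z} \<union> G {z, w 2} else G {u i, w j})" for i j
  show False
  proof (rule K33_not_planar[of S "\<lambda>i. p (u i)" "\<lambda>j. p (w j)"])
    fix i j :: nat assume lt: "i < 3" "j < 3"
    have "G {u 2, z} \<inter> G {z, w 2} = {p z}"
      using edges by (subst Gint) (auto simp: neq doubleton_eq_iff)
    then have "arc_joins (G {u 2, z} \<union> G {z, w 2}) (p (u 2)) (p (w 2))"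
      using edges by (intro arc_joins_Un[of _ _ "p z"] G) auto
    then show "arc_joins (S i j) (p (u i)) (p (w j))"
      using lt edges unfolding S_def by (auto intro: G)
    {
      fix l :: nat assume "l < 3" "j \<noteq> l"
      then show "S i j \<inter> S i l = {p (u i)}"
        using lt edges unfolding S_def
        by (auto simp: Int_Un_distrib Int_Un_distrib2 Gint neq doubleton_eq_iff simp del: Int_iff)
    }
    {
      fix k :: nat assume "k < 3" "i \<noteq> k"
      then show "S i j \<inter> S k j = {p (w j)}"
        using lt edges unfolding S_def
        by (auto simp: Int_Un_distrib Int_Un_distrib2 Gint neq doubleton_eq_iff simp del: Int_iff)
    }
    fix k l :: nat assume "k < 3" "l < 3" "i \<noteq> k" "j \<noteq> l"
    then show "S i j \<inter> S k l = {}"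
      using lt edges unfolding S_def
      by (auto simp: Int_Un_distrib Int_Un_distrib2 Gint neq doubleton_eq_iff simp del: Int_iff)
  qed
qed

lemma class_D3_not_planar:
  assumes "class_D3 V E"
  shows "\<not> planar_graph V E"
proof
  assume planar: "planar_graph V E"
  obtain V1 V2 V3 x1 x3 y1 y2 y3 where
    disj: "V1 \<inter> V2 = {}" "V1 \<inter> V3 = {}" "V2 \<inter> V3 = {}" and V3: "card V3 = 1"
    and mem: "x1 \<in> V1" "x3 \<in> V3" "y1 \<in> V2" "y2 \<in> V1" "y3 \<in> V2"
    and x3: "{x3, y1} \<notin> E" "{x3, y2} \<notin> E" "{x3, y3} \<in> E" "{x1, x3} \<in> E"
    and y1: "\<forall>v\<in>V1. {y1, v} \<in> E" and y2: "\<forall>w\<in>V2. {y2, w} \<in> E"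
    and full: "\<forall>v\<in>V1 - {x1, y2}. (\<forall>w\<in>V2. {v, w} \<in> E) \<noteq> (\<forall>z\<in>V3. {v, z} \<in> E)"
      "\<forall>w\<in>V2 - {y3, y1}. (\<forall>v\<in>V1. {w, v} \<in> E) \<noteq> (\<forall>z\<in>V3. {w, z} \<in> E)"
    and card: "card {v \<in> V1. {x3, v} \<notin> E} \<ge> 2" "card {w \<in> V2. {x3, w} \<notin> E} \<ge> 2"
    using assms unfolding class_D3_def by (elim exE conjE) (rule that)
  have V3: "V3 = {x3}" using V3 mem(2) by (auto simp: card_1_singleton_iff)
  obtain a1 a2 where a: "a1 \<in> V1" "{x3, a1} \<notin> E" "a2 \<in> V1" "{x3, a2} \<notin> E" "a1 \<noteq> a2"
    using card(1) by (auto simp: numeral_2_eq_2 card_le_Suc_iff)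
  obtain b1 b2 where b: "b1 \<in> V2" "{x3, b1} \<notin> E" "b2 \<in> V2" "{x3, b2} \<notin> E" "b1 \<noteq> b2"
    using card(2) by (auto simp: numeral_2_eq_2 card_le_Suc_iff)
  \<comment> \<open>For \<open>y2\<close> this is condition (a). Otherwise (d) applies, since
    \<open>x1\<close> is a neighbor of \<open>x3\<close>, and missing \<open>V3 = {x3}\<close>
    forces being joined to all of \<open>V2\<close>.\<close>
  have A: "\<forall>w\<in>V2. {v, w} \<in> E" if v: "v \<in> V1" "{x3, v} \<notin> E" for v
  proof (cases "v = y2")
    case False
    moreover have "v \<noteq> x1" using v x3(4) by (auto simp: insert_commute)
    ultimately have "(\<forall>w\<in>V2. {v, w} \<in> E) \<noteq> ({v, x3} \<in> E)"
      using full(1) v(1) V3 by simp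
    with v(2) show ?thesis by (simp add: insert_commute)
  qed (use y2 in simp)
  have B: "\<forall>v\<in>V1. {w, v} \<in> E" if w: "w \<in> V2" "{x3, w} \<notin> E" for w
  proof (cases "w = y1")
    case False
    moreover have "w \<noteq> y3" using w x3(3) by auto
    ultimately have "(\<forall>v\<in>V1. {w, v} \<in> E) \<noteq> ({w, x3} \<in> E)"
      using full(2) w(1) V3 by simp
    with w(2) show ?thesis by (simp add: insert_commute)
  qed (use y1 in simp)
  have ne: "a1 \<noteq> x1" "a2 \<noteq> x1" "b1 \<noteq> y3" "b2 \<noteq> y3"
    using a b x3 by (auto simp: insert_commute)
  have less_3: "i = 0 \<or> i = 1 \<or> i = 2" if "i < 3" for i :: nat
    using that by auto
  \<comment> \<open>\<open>x1\<close> and \<open>y3\<close> come last because they are not adjacent: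
    the pair of indices 2, 2 is the one connected through \<open>x3\<close>.\<close>
  let ?u = "\<lambda>i. [a1, a2, x1] ! i" and ?w = "\<lambda>j. [b1, b2, y3] ! j"
  show False
  proof (rule planar_graph_subdivided_K33[OF planar, of ?u ?w x3])
    show "inj_on ?u {..<3}" "inj_on ?w {..<3}"
      using a b ne by (auto simp: inj_on_def dest!: less_3)
    show "?u i \<noteq> ?w j" if "i < 3" "j < 3" for i j
      using less_3[OF that(1)] less_3[OF that(2)] a b mem disj by auto
    show "?u i \<noteq> x3" "?w i \<noteq> x3" if "i < 3" for i
      using less_3[OF that] a b mem disj by auto
    show "{?u i, ?w j} \<in> E" if "i < 3" "j < 3" "i \<noteq> 2 \<or> j \<noteq> 2" for i j
    proof -
      have "{x1, b1} \<in> E" "{x1, b2} \<in> E"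
        using bspec[OF B[OF b(1,2)] mem(1)] bspec[OF B[OF b(3,4)] mem(1)]
        by (simp_all add: insert_commute)
      moreover have "{a1, b1} \<in> E" "{a1, b2} \<in> E" "{a1, y3} \<in> E"
        "{a2, b1} \<in> E" "{a2, b2} \<in> E" "{a2, y3} \<in> E"
        using A[OF a(1,2)] A[OF a(3,4)] b mem(5) by simp_all
      ultimately show ?thesis
        using less_3[OF that(1)] less_3[OF that(2)] that(3) by (elim disjE) simp_all
    qed
    show "{?u 2, x3} \<in> E" "{x3, ?w 2} \<in> E" using x3 by auto
  qed
qed

subsection \<open>Domination and dominator colorings\<close>

lemma Least_nat_eq_iff:
  fixes n :: nat
  assumes "\<exists>k. P k"
  shows "(LEAST k. P k) = n \<longleftrightarrow> P n \<and> (\<forall>k. P k \<longrightarrow> n \<le> k)"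
  using assms by (metis LeastI_ex Least_le Least_equality)

lemma simple_graph_no_loop: "simple_graph V E \<Longrightarrow> {v} \<notin> E"
  unfolding simple_graph_def by (metis insertI1 insert_commute singletonD)

text \<open>Shows that the minima defining \<chi> and \<chi>_d range over nonempty sets, so that
  \<open>LEAST\<close> is attained.\<close>

lemma dominator_coloring_singletons:
  assumes "simple_graph V E"
  shows "dominator_coloring V E ((\<lambda>v. {v}) ` V)"
proof -
  have "partition_on V ((\<lambda>v. {v}) ` V)"
    by (auto simp: partition_on_def disjoint_def)
  then show ?thesis
    using simple_graph_no_loop[OF assms]
    unfolding dominator_coloring_def coloring_def independent_set_def by auto
qed

text \<open>A dominator coloring is a coloring. Hence one with \<open>n\<close> classes, together
  with the lower bound for all colorings, settles both chromatic parameters.\<close>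

lemma D_graph_iff:
  assumes "simple_graph V E"
  shows "D_graph n V E \<longleftrightarrow>
    (\<exists>S. dominating_set V E S \<and> card S = n) \<and> (\<forall>S. dominating_set V E S \<longrightarrow> n \<le> card S) \<and>
    (\<exists>C. dominator_coloring V E C \<and> card C = n) \<and> (\<forall>C. coloring V E C \<longrightarrow> n \<le> card C)"
proof -
  have "\<exists>k S. dominating_set V E S \<and> card S = k"
    unfolding dominating_set_def by blast
  moreover have "\<exists>k C. dominator_coloring V E C \<and> card C = k"
    using dominator_coloring_singletons[OF assms] by blast
  moreover from this have "\<exists>k C. coloring V E C \<and> card C = k"
    unfolding dominator_coloring_def by blast
  ultimately show ?thesis
    unfolding D_graph_def domination_number_def chromatic_number_def dominator_chromatic_number_def
    by (simp add: Least_nat_eq_iff) (auto simp: dominator_coloring_def)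
qed

text \<open>A set of at most two vertices is contained in some \<open>{s, t}\<close>, with
  \<open>s = t\<close> allowed, and a larger set within \<open>V\<close> still dominates. So it is
  enough that no such pair dominates.\<close>

lemma dominating_set_card_ge_3_iff:
  assumes "finite V" "V \<noteq> {}"
  shows "(\<forall>S. dominating_set V E S \<longrightarrow> 3 \<le> card S) \<longleftrightarrow>
    (\<forall>s\<in>V. \<forall>t\<in>V. \<exists>v\<in>V. v \<noteq> s \<and> v \<noteq> t \<and> {s, v} \<notin> E \<and> {t, v} \<notin> E)"
    (is "?L \<longleftrightarrow> ?R")
proof
  assume L: ?L
  show ?R
  proof (intro ballI)
    fix s t assume "s \<in> V" "t \<in> V"
    have "card {s, t} \<le> 2" by (simp add: card_insert_if)
    then have "\<not> dominating_set V E {s, t}" using L by fastforce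
    then show "\<exists>v\<in>V. v \<noteq> s \<and> v \<noteq> t \<and> {s, v} \<notin> E \<and> {t, v} \<notin> E"
      using \<open>s \<in> V\<close> \<open>t \<in> V\<close> unfolding dominating_set_def by blast
  qed
next
  assume R: ?R
  show ?L
  proof (intro allI impI, rule ccontr)
    fix S assume S: "dominating_set V E S" "\<not> 3 \<le> card S"
    then have "S \<subseteq> V" "finite S"
      using assms(1) finite_subset unfolding dominating_set_def by blast+
    have "\<exists>s\<in>V. \<exists>t\<in>V. S \<subseteq> {s, t}"
    proof -
      have "card S = 0 \<or> card S = 1 \<or> card S = 2" using S(2) by linarith
      then show ?thesis
        using \<open>S \<subseteq> V\<close> \<open>finite S\<close> assms(2) by (auto simp: card_1_singleton_iff card_2_iff)
    qed
    then obtain s t where st: "s \<in> V" "t \<in> V" "S \<subseteq> {s, t}" by blast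
    with R obtain v where "v \<in> V" "v \<noteq> s" "v \<noteq> t" "{s, v} \<notin> E" "{t, v} \<notin> E" by blast
    then show False
      using S(1) st unfolding dominating_set_def by blast
  qed
qed

section \<open>Consequences of having few colors and no dominating pair\<close>

lemma coloring_minimal_classes_adjacent:
  assumes C: "coloring V E C" "finite V" and min: "\<And>C'. coloring V E C' \<Longrightarrow> card C \<le> card C'"
    and A: "A \<in> C" and B: "B \<in> C" and "A \<noteq> B"
  shows "\<exists>a\<in>A. \<exists>b\<in>B. {a, b} \<in> E"
proof (rule ccontr)
  assume none: "\<not> ?thesis"
  let ?D = "insert (A \<union> B) (C - {A, B})" \<comment> \<open>merging \<open>A\<close> and \<open>B\<close> saves a color\<close>
  have part: "partition_on V C" and ind: "\<And>X. X \<in> C \<Longrightarrow> independent_set V E X"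
    using C by (auto simp: coloring_def)
  have "finite C" using C(2) part finite_elements by blast
  have "\<Union> C = V" "{} \<notin> C" and disj: "\<And>X Y. X \<in> C \<Longrightarrow> Y \<in> C \<Longrightarrow> X \<noteq> Y \<Longrightarrow> X \<inter> Y = {}"
    using part by (auto simp: partition_on_def disjoint_def)
  then have "\<Union> ?D = V" using A B by blast
  moreover have "X \<inter> Y = {}" if "X \<in> ?D" "Y \<in> ?D" "X \<noteq> Y" for X Y
    using that disj A B by (auto simp: Int_Un_distrib Int_Un_distrib2)
  moreover have "{} \<notin> ?D" using \<open>{} \<notin> C\<close> A by auto
  ultimately have "partition_on V ?D" by (simp add: partition_on_def disjoint_def)
  moreover have "independent_set V E (A \<union> B)"
    using ind[OF A] ind[OF B] none unfolding independent_set_def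
    by (auto simp: insert_commute) (metis insert_commute)
  ultimately have "coloring V E ?D"
    using ind by (auto simp: coloring_def)
  then have "card C \<le> card ?D" by (rule min)
  also have "card ?D \<le> Suc (card (C - {A, B}))"
    using \<open>finite C\<close> by (simp add: card_insert_if)
  also have "card (C - {A, B}) = card C - 2"
    using A B \<open>A \<noteq> B\<close> by (subst card_Diff_subset) auto
  finally have "card C \<le> Suc (card C - 2)" .
  \<comment> \<open>Subtraction on naturals truncates; only with at least two classes is
    \<open>Suc (card C - 2)\<close> smaller than \<open>card C\<close>.\<close>
  moreover have "card {A, B} \<le> card C"
    using A B \<open>finite C\<close> by (intro card_mono) auto
  ultimately show False using \<open>A \<noteq> B\<close> by simp
qed

text \<open>If at most one vertex \<open>b\<close> of \<open>P\<close> misses \<open>x\<close>, then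
  \<open>{x, b}\<close> dominates: the rest of \<open>P\<close> is adjacent to \<open>x\<close>, and
  each vertex of \<open>Q\<close> is adjacent to \<open>x\<close> or to all of \<open>P\<close>,
  including \<open>b\<close>.\<close>

lemma two_nonneighbours:
  assumes fin: "finite V" and V: "V = P \<union> Q \<union> {x}" and "P \<noteq> {}"
    and P: "\<And>v. v \<in> P \<Longrightarrow> (\<forall>w\<in>Q. {v, w} \<in> E) \<or> {x, v} \<in> E"
    and Q: "\<And>w. w \<in> Q \<Longrightarrow> (\<forall>v\<in>P. {w, v} \<in> E) \<or> {x, w} \<in> E"
    and far: "\<And>s t. s \<in> V \<Longrightarrow> t \<in> V \<Longrightarrow>
      \<exists>v\<in>V. v \<noteq> s \<and> v \<noteq> t \<and> {s, v} \<notin> E \<and> {t, v} \<notin> E"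
  shows "2 \<le> card {v \<in> P. {x, v} \<notin> E}"
proof (rule ccontr)
  define A where "A = {v \<in> P. {x, v} \<notin> E}"
  assume "\<not> ?thesis"
  then have "card A = 0 \<or> card A = 1" unfolding A_def by linarith
  moreover have "finite A" using fin V by (simp add: A_def)
  ultimately have "A = {} \<or> (\<exists>b. A = {b})"
    by (auto simp: card_1_singleton_iff)
  moreover have "A \<subseteq> P" by (auto simp: A_def)
  \<comment> \<open>If \<open>A\<close> is empty, any vertex of \<open>P\<close> serves as
    \<open>b\<close>.\<close>
  ultimately obtain b where b: "b \<in> P" "A \<subseteq> {b}"
    using \<open>P \<noteq> {}\<close> by blast
  obtain v where v: "v \<in> V" "v \<noteq> x" "v \<noteq> b" "{x, v} \<notin> E" "{b, v} \<notin> E"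
    using far[of x b] V b(1) by blast
  have "v \<notin> P" using v b by (auto simp: A_def)
  then have "v \<in> Q" using v V by blast
  then have "{v, b} \<in> E" using Q v b(1) by blast
  then show False using v by (simp add: insert_commute)
qed

text \<open>If \<open>v\<close> were joined to \<open>x\<close> as well as to all of
  \<open>Q\<close>, then \<open>{v, b}\<close> would dominate, because \<open>b\<close> misses
  \<open>x\<close> and is therefore joined to all of \<open>P\<close>. This is the source of "but
  not both" in (d).\<close>

lemma dominates_not_adjacent_centre:
  assumes V: "V = P \<union> Q \<union> {x}"
    and Q: "\<And>w. w \<in> Q \<Longrightarrow> (\<forall>v\<in>P. {w, v} \<in> E) \<or> {x, w} \<in> E"
    and far: "\<And>s t. s \<in> V \<Longrightarrow> t \<in> V \<Longrightarrow>
      \<exists>v\<in>V. v \<noteq> s \<and> v \<noteq> t \<and> {s, v} \<notin> E \<and> {t, v} \<notin> E"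
    and b: "b \<in> Q" "{x, b} \<notin> E" and v: "v \<in> P" "\<forall>w\<in>Q. {v, w} \<in> E"
  shows "{x, v} \<notin> E"
proof
  assume xv: "{x, v} \<in> E"
  obtain z where z: "z \<in> V" "z \<noteq> v" "z \<noteq> b" "{v, z} \<notin> E" "{b, z} \<notin> E"
    using far[of v b] V v(1) b(1) by blast
  then have "z \<in> P"
    using V v(2) xv by (auto simp: insert_commute)
  then show False using Q[OF b(1)] b(2) z(5) by blast
qed

text \<open>Without singleton classes every vertex is joined to all of some other class. Following
  which class is chosen leads to two classes with vertices that are each joined to the whole class
  of the other, and such a pair dominates.\<close>

lemma dominator_coloring_singleton_class:
  assumes V: "V = A \<union> B \<union> D" and nonempty: "A \<noteq> {}" "B \<noteq> {}" "D \<noteq> {}"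
    and dom: "\<And>v. v \<in> V \<Longrightarrow> {v} \<in> {A, B, D} \<or> (\<exists>X\<in>{A, B, D}. \<forall>u\<in>X. {v, u} \<in> E)"
    and indep: "\<And>X u v. X \<in> {A, B, D} \<Longrightarrow> u \<in> X \<Longrightarrow> v \<in> X \<Longrightarrow> {u, v} \<notin> E"
    and far: "\<And>s t. s \<in> V \<Longrightarrow> t \<in> V \<Longrightarrow>
      \<exists>v\<in>V. v \<noteq> s \<and> v \<noteq> t \<and> {s, v} \<notin> E \<and> {t, v} \<notin> E"
  shows "\<exists>x. {x} \<in> {A, B, D}"
proof (rule ccontr)
  assume none: "\<not> ?thesis"
  define doms where "doms v X \<longleftrightarrow> (\<forall>u\<in>X. {v, u} \<in> E)" for v X
  have own: "\<not> doms v X" if "v \<in> X" "X \<in> {A, B, D}" for v X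
    using indep that unfolding doms_def by blast
  have ex: "\<exists>X\<in>{A, B, D}. doms v X" if "v \<in> V" for v
    using dom[OF that] none unfolding doms_def by blast
  \<comment> \<open>Equality of the two sets of classes expresses a renaming, so that the arguments
    below apply to the classes in any order.\<close>
  have classes: "V = X \<union> Y \<union> Z" if "{X, Y, Z} = {A, B, D}" for X Y Z
  proof -
    have "\<Union>{X, Y, Z} = \<Union>{A, B, D}" using that by simp
    then show ?thesis using V by (simp add: Un_assoc)
  qed
  \<comment> \<open>A vertex missed by \<open>x\<close> and \<open>y\<close> must be in
    \<open>Z\<close>; but it is joined to all of \<open>X\<close> or all of \<open>Y\<close>, hence
    to \<open>x\<close> or \<open>y\<close>.\<close>
  have mutual: False
    if XYZ: "{X, Y, Z} = {A, B, D}" and xy: "x \<in> X" "doms x Y" "y \<in> Y" "doms y X" for X Y Z x y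
  proof -
    have V': "V = X \<union> Y \<union> Z" using classes[OF XYZ] .
    then obtain v where v: "v \<in> V" "{x, v} \<notin> E" "{y, v} \<notin> E"
      using far[of x y] xy by blast
    then have "v \<in> Z" using V' xy unfolding doms_def by blast
    then have "doms v X \<or> doms v Y"
      using ex[OF v(1)] own[of v Z] unfolding XYZ[symmetric] by blast
    then show False using v xy unfolding doms_def by (metis insert_commute)
  qed
  \<comment> \<open>By \<open>mutual\<close> no vertex of \<open>Y\<close> is joined to all of
    \<open>X\<close>, so all of \<open>Y\<close> is joined to all of \<open>Z\<close>. Then
    \<open>Y\<close> and \<open>Z\<close> form a mutual pair.\<close>
  have step: False if XYZ: "{X, Y, Z} = {A, B, D}" and x: "x \<in> X" "doms x Y" for X Y Z x
  proof -
    have V': "V = X \<union> Y \<union> Z" using classes[OF XYZ] .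
    have in3: "X \<in> {A, B, D}" "Y \<in> {A, B, D}" "Z \<in> {A, B, D}" using XYZ by blast+
    have YZ: "doms y Z" if "y \<in> Y" for y
    proof -
      have "\<not> doms y X" using mutual[OF XYZ x that] by blast
      moreover have "\<not> doms y Y" using own[OF that in3(2)] .
      ultimately show ?thesis using ex[of y] that V' unfolding XYZ[symmetric] by blast
    qed
    obtain y where y: "y \<in> Y" using in3(2) nonempty by blast
    obtain z where z: "z \<in> Z" using in3(3) nonempty by blast
    have "doms z Y" using YZ z unfolding doms_def by (metis insert_commute)
    moreover have "{Y, Z, X} = {A, B, D}" unfolding XYZ[symmetric] by blast
    ultimately show False using mutual[of Y Z X y z] YZ[OF y] y z by blast
  qed
  obtain x where "x \<in> A" using nonempty by blast
  then have "doms x B \<or> doms x D" using ex[of x] own[of x A] V by blast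
  moreover have "{A, D, B} = {A, B, D}" by blast
  ultimately show False using step[of A B D x] step[of A D B x] \<open>x \<in> A\<close> by blast
qed

section \<open>From D(3) graphs to the class\<close>

lemma D_graph_imp_class_D3:
  assumes graph: "simple_graph V E" and D: "D_graph 3 V E"
  shows "class_D3 V E"
proof -
  have fin: "finite V" "V \<noteq> {}" using graph by (auto simp: simple_graph_def)
  have far: "\<exists>v\<in>V. v \<noteq> s \<and> v \<noteq> t \<and> {s, v} \<notin> E \<and> {t, v} \<notin> E" if "s \<in> V" "t \<in> V" for s t
    using D that fin dominating_set_card_ge_3_iff[of V E] unfolding D_graph_iff[OF graph] by blast
  obtain C where C: "dominator_coloring V E C" "card C = 3"
    and min: "\<And>C'. coloring V E C' \<Longrightarrow> 3 \<le> card C'"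
    using D unfolding D_graph_iff[OF graph] by blast
  have col: "coloring V E C" using C(1) by (simp add: dominator_coloring_def)
  then have union: "\<Union> C = V" and ne: "{} \<notin> C"
    and disj: "\<And>X Y. X \<in> C \<Longrightarrow> Y \<in> C \<Longrightarrow> X \<noteq> Y \<Longrightarrow> X \<inter> Y = {}"
    and ind: "\<And>X. X \<in> C \<Longrightarrow> independent_set V E X"
    by (auto simp: coloring_def partition_on_def disjoint_def)
  have dom: "{v} \<in> C \<or> (\<exists>X\<in>C. \<forall>u\<in>X. {v, u} \<in> E)" if "v \<in> V" for v
    using C(1) that by (simp add: dominator_coloring_def)
  have touch: "\<exists>a\<in>X. \<exists>b\<in>Y. {a, b} \<in> E" if "X \<in> C" "Y \<in> C" "X \<noteq> Y" for X Y
    using coloring_minimal_classes_adjacent[OF col fin(1) _ that] min C(2) by simp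
  have "\<exists>x. {x} \<in> C"
  proof -
    obtain A B F where ABF: "C = {A, B, F}" using C(2) by (auto simp: card_3_iff)
    show ?thesis
      unfolding ABF
    proof (rule dominator_coloring_singleton_class)
      show "V = A \<union> B \<union> F" "A \<noteq> {}" "B \<noteq> {}" "F \<noteq> {}"
        using union ne unfolding ABF by auto
      show "{v} \<in> {A, B, F} \<or> (\<exists>X\<in>{A, B, F}. \<forall>u\<in>X. {v, u} \<in> E)" if "v \<in> V" for v
        using dom[OF that] unfolding ABF .
      show "{u, v} \<notin> E" if "X \<in> {A, B, F}" "u \<in> X" "v \<in> X" for X u v
        using ind[of X] that unfolding ABF independent_set_def by blast
    qed (rule far)
  qed
  then obtain x3 where x3: "{x3} \<in> C" ..
  then have "card (C - {{x3}}) = 2" using C(2) by simp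
  then obtain V1 V2 where V12: "C - {{x3}} = {V1, V2}" "V1 \<noteq> V2" by (auto simp: card_2_iff)
  then have C3: "C = {V1, V2, {x3}}" "V1 \<noteq> {x3}" "V2 \<noteq> {x3}" using x3 by blast+
  have V: "V = V1 \<union> V2 \<union> {x3}" using union C3(1) by blast
  have nonempty: "V1 \<noteq> {}" "V2 \<noteq> {}" using ne C3(1) by blast+
  have disjoint: "V1 \<inter> V2 = {}" "V1 \<inter> {x3} = {}" "V2 \<inter> {x3} = {}"
    using disj C3 V12(2) by blast+
  have indep: "independent_set V E V1" "independent_set V E V2" "independent_set V E {x3}"
    using ind C3(1) by auto
  \<comment> \<open>Besides \<open>{x3}\<close> no class is a singleton: a vertex \<open>v\<close>
    missed by \<open>s\<close> and \<open>x3\<close> lies in \<open>Q\<close>. If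
    \<open>Q = {v}\<close>, there is no edge between \<open>P\<close> and \<open>Q\<close>, against
    minimality of the coloring; otherwise \<open>v\<close> is joined to \<open>s\<close> or
    \<open>x3\<close>.\<close>
  have only: "{s} \<noteq> P" if PQ: "C = {P, Q, {x3}}" "P \<noteq> {x3}" "Q \<noteq> {x3}" "P \<noteq> Q" for s P Q
  proof
    assume s: "{s} = P"
    have V': "V = {s} \<union> Q \<union> {x3}" using union PQ(1) s by blast
    obtain v where v: "v \<in> V" "v \<noteq> s" "v \<noteq> x3" "{s, v} \<notin> E" "{x3, v} \<notin> E"
      using far[of s x3] V' by blast
    then have vQ: "v \<in> Q" using V' by blast
    consider "{v} \<in> C" | X where "X \<in> C" "\<forall>u\<in>X. {v, u} \<in> E" using dom[OF v(1)] by blast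
    then show False
    proof cases
      case 1
      then have "Q = {v}" using PQ(1) v s by auto
      then show False using touch[of P Q] PQ s v by (auto simp: insert_commute)
    next
      case 2
      have "X \<noteq> Q"
        using 2(2) vQ ind[of Q] PQ(1) unfolding independent_set_def by blast
      then have "X = {s} \<or> X = {x3}" using 2(1) PQ(1) s by blast
      then show False using 2(2) v by (auto simp: insert_commute)
    qed
  qed
  have big: "\<nexists>s. V1 = {s}" "\<nexists>s. V2 = {s}"
    using only[of V1 V2] only[of V2 V1] C3 V12(2) by (metis insert_commute)+
  have dom_V1: "(\<forall>w\<in>V2. {v, w} \<in> E) \<or> {x3, v} \<in> E" if v: "v \<in> V1" for v
  proof -
    have "{v} \<notin> C" using C3(1) big v disjoint by blast
    then obtain X where X: "X \<in> C" "\<forall>u\<in>X. {v, u} \<in> E" using dom[of v] v V by blast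
    have "X \<noteq> V1" using X v indep(1) unfolding independent_set_def by blast
    then show ?thesis using X C3(1) by (auto simp: insert_commute)
  qed
  have dom_V2: "(\<forall>v\<in>V1. {w, v} \<in> E) \<or> {x3, w} \<in> E" if w: "w \<in> V2" for w
  proof -
    have "{w} \<notin> C" using C3(1) big w disjoint by blast
    then obtain X where X: "X \<in> C" "\<forall>u\<in>X. {w, u} \<in> E" using dom[of w] w V by blast
    have "X \<noteq> V2" using X w indep(2) unfolding independent_set_def by blast
    then show ?thesis using X C3(1) by (auto simp: insert_commute)
  qed
  have V': "V = V2 \<union> V1 \<union> {x3}" using V by blast
  have card_A: "2 \<le> card {v \<in> V1. {x3, v} \<notin> E}"
    using two_nonneighbours[OF fin(1) V nonempty(1) dom_V1 dom_V2 far] .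
  have card_B: "2 \<le> card {w \<in> V2. {x3, w} \<notin> E}"
    using two_nonneighbours[OF fin(1) V' nonempty(2) dom_V2 dom_V1 far] .
  \<comment> \<open>Any non-neighbors of \<open>x3\<close> serve as \<open>y2\<close> and
    \<open>y1\<close>: missing \<open>x3\<close>, they are joined to the whole opposite
    class.\<close>
  obtain y2 where y2: "y2 \<in> V1" "{x3, y2} \<notin> E"
    using card_A by (auto simp: numeral_2_eq_2 card_le_Suc_iff)
  obtain y1 where y1: "y1 \<in> V2" "{x3, y1} \<notin> E"
    using card_B by (auto simp: numeral_2_eq_2 card_le_Suc_iff)
  have not_both_V1: "{x3, v} \<notin> E" if "v \<in> V1" "\<forall>w\<in>V2. {v, w} \<in> E" for v
    using dominates_not_adjacent_centre[OF V dom_V2 far y1 that] .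
  have not_both_V2: "{x3, w} \<notin> E" if "w \<in> V2" "\<forall>v\<in>V1. {w, v} \<in> E" for w
    using dominates_not_adjacent_centre[OF V' dom_V1 far y2 that] .
  have y1_all: "\<forall>v\<in>V1. {y1, v} \<in> E" using dom_V2 y1 by blast
  have y2_all: "\<forall>w\<in>V2. {y2, w} \<in> E" using dom_V1 y2 by blast
  \<comment> \<open>Minimality of the coloring yields an edge from \<open>x3\<close> to
    \<open>V1\<close>. Its end \<open>x1\<close> cannot also be joined to all of \<open>V2\<close>,
    which yields \<open>y3\<close>; missing \<open>x1\<close>, in turn, \<open>y3\<close> must be
    adjacent to \<open>x3\<close>.\<close>
  obtain x1 where x1: "x1 \<in> V1" "{x3, x1} \<in> E"
    using touch[of "{x3}" V1] C3 by blast
  obtain y3 where y3: "y3 \<in> V2" "{x1, y3} \<notin> E"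
    using not_both_V1 x1 by blast
  have x3y3: "{x3, y3} \<in> E"
    using dom_V2[OF y3(1)] x1(1) y3(2) by (auto simp: insert_commute)
  \<comment> \<open>Two non-neighbors of \<open>x3\<close> and one neighbor make three
    vertices.\<close>
  have card_3: "3 \<le> card P" if "P \<subseteq> V" "2 \<le> card {v \<in> P. {x3, v} \<notin> E}" "u \<in> P" "{x3, u} \<in> E" for P u
  proof -
    have "finite P" using that(1) fin(1) finite_subset by blast
    moreover from this have "card (insert u {v \<in> P. {x3, v} \<notin> E}) \<le> card P"
      using that(3) by (intro card_mono) auto
    ultimately show ?thesis using that by simp
  qed
  have E1: "(\<forall>w\<in>V2. {v, w} \<in> E) \<noteq> ({v, x3} \<in> E)" if "v \<in> V1" for v
    using that dom_V1[OF that] not_both_V1[OF that] by (auto simp: insert_commute)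
  have E2: "(\<forall>v\<in>V1. {w, v} \<in> E) \<noteq> ({w, x3} \<in> E)" if "w \<in> V2" for w
    using that dom_V2[OF that] not_both_V2[OF that] by (auto simp: insert_commute)
  \<comment> \<open>Condition (e) says that \<open>{x, y}\<close> does not dominate. As
    \<open>x\<close> misses \<open>y\<close>, it is adjacent to \<open>x3\<close>, so the vertex
    left over lies in \<open>V1\<close> or \<open>V2\<close>.\<close>
  have nonadj: "(\<exists>w\<in>V2 - {y}. {x, w} \<notin> E) \<or> (\<exists>v\<in>V1 - {x}. {y, v} \<notin> E)"
    if xy: "x \<in> V1" "y \<in> V2" "{x, y} \<notin> E" for x y
  proof -
    obtain z where z: "z \<in> V" "z \<noteq> x" "z \<noteq> y" "{x, z} \<notin> E" "{y, z} \<notin> E"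
      using far[of x y] V xy by blast
    have "{x3, x} \<in> E" using dom_V1 xy by blast
    then have "z \<noteq> x3" using z by (auto simp: insert_commute)
    then show ?thesis using z V by blast
  qed
  show ?thesis
    unfolding class_D3_def
  proof (intro exI conjI)
    show "V = V1 \<union> V2 \<union> {x3}" by (rule V)
    show "V1 \<inter> V2 = {}" "V1 \<inter> {x3} = {}" "V2 \<inter> {x3} = {}" by (rule disjoint)+
    show "independent_set V E V1" "independent_set V E V2" "independent_set V E {x3}"
      by (rule indep)+
    show "3 \<le> card V1" using card_3[OF _ card_A x1] V by blast
    show "3 \<le> card V2" using card_3[OF _ card_B y3(1) x3y3] V by blast
    \<comment> \<open>The vertex called \<open>x2\<close> in the class is taken to be
      \<open>y3\<close>; the required non-edge between \<open>x2\<close> and \<open>y3\<close> is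
      then the absence of a loop.\<close>
    show "x1 \<in> V1" "y3 \<in> V2" "x3 \<in> {x3}" "y1 \<in> V2" "y2 \<in> V1" "y3 \<in> V2"
      using x1 y1 y2 y3 by simp_all
    show "{x1, y1} \<in> E" using y1_all x1 by (auto simp: insert_commute)
    show "{x1, y2} \<notin> E" using indep(1) x1 y2 unfolding independent_set_def by blast
    show "{y3, y1} \<notin> E" "{y3, y3} \<notin> E"
      using indep(2) y3 y1 unfolding independent_set_def by blast+
    show "{y3, y2} \<in> E" using y2_all y3 by (auto simp: insert_commute)
    show "{x1, x3} \<in> E" using x1 by (simp add: insert_commute)
    show "\<exists>w\<in>V2 - {y3}. {x1, w} \<in> E"
      using \<open>{x1, y1} \<in> E\<close> y1 x3y3 by blast
    show "\<exists>v\<in>V1 - {x1}. {y3, v} \<in> E"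
      using \<open>{y3, y2} \<in> E\<close> y2 x1 by blast
    show "\<forall>v\<in>V1 - {x1, y2}. (\<forall>w\<in>V2. {v, w} \<in> E) \<noteq> (\<forall>z\<in>{x3}. {v, z} \<in> E)"
      using E1 by simp
    show "\<forall>w\<in>V2 - {y3, y1}. (\<forall>v\<in>V1. {w, v} \<in> E) \<noteq> (\<forall>z\<in>{x3}. {w, z} \<in> E)"
      using E2 by simp
    show "\<forall>x\<in>V1. \<forall>y\<in>V2. {x, y} \<notin> E \<longrightarrow>
        (\<exists>w\<in>V2 - {y}. {x, w} \<notin> E) \<or> (\<exists>v\<in>V1 - {x}. {y, v} \<notin> E)"
      using nonadj by blast
  qed (use y1 y2 y3 x3y3 y1_all y2_all card_A card_B in simp_all)
qed

section \<open>From the class to D(3) graphs\<close>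

text \<open>With at most two classes, the class would have to alternate along a closed walk of odd
  length.\<close>

lemma five_cycle_coloring_card:
  assumes "finite V" "coloring V E C" and "{a, b, c, d, e} \<subseteq> V"
    and "{a, b} \<in> E" "{b, c} \<in> E" "{c, d} \<in> E" "{d, e} \<in> E" "{e, a} \<in> E"
  shows "3 \<le> card C"
proof (rule ccontr)
  assume small: "\<not> ?thesis"
  have part: "partition_on V C" and ind: "\<And>X. X \<in> C \<Longrightarrow> independent_set V E X"
    using assms(2) by (auto simp: coloring_def)
  have "finite C" using assms(1) part finite_elements by blast
  have "\<forall>v\<in>V. \<exists>X\<in>C. v \<in> X" using part by (auto simp: partition_on_def)
  then obtain f where f: "\<And>v. v \<in> V \<Longrightarrow> f v \<in> C \<and> v \<in> f v" by metis
  have two: "X = Y \<or> Y = Z \<or> X = Z" if "X \<in> C" "Y \<in> C" "Z \<in> C" for X Y Z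
  proof (rule ccontr)
    assume "\<not> ?thesis"
    then have "card {X, Y, Z} = 3" by simp
    moreover have "card {X, Y, Z} \<le> card C"
      using that \<open>finite C\<close> by (intro card_mono) auto
    ultimately show False using small by simp
  qed
  have "f u \<noteq> f v" if "u \<in> V" "v \<in> V" "{u, v} \<in> E" for u v
    using f[OF that(1)] f[OF that(2)] ind[of "f u"] that(3) unfolding independent_set_def by metis
  then have "f a \<noteq> f b" "f b \<noteq> f c" "f c \<noteq> f d" "f d \<noteq> f e" "f e \<noteq> f a"
    using assms(3-) by auto
  moreover have "f a \<in> C" "f b \<in> C" "f c \<in> C" "f d \<in> C" "f e \<in> C"
    using f assms(3) by auto
  ultimately show False using two by metis
qed

text \<open>The upper bounds come from the dominator coloring \<open>{V1, V2, {x3}}\<close> and the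
  dominating set \<open>{x3, y1, y2}\<close>, the lower bound on colors from the 5-cycle. What
  remains is that no two vertices dominate.\<close>

lemma class_D3_imp_D_graph:
  assumes graph: "simple_graph V E" and "class_D3 V E"
  shows "D_graph 3 V E"
proof -
  have fin: "finite V" "V \<noteq> {}" using graph by (auto simp: simple_graph_def)
  obtain V1 V2 V3 x1 x3 y1 y2 y3 where
    V: "V = V1 \<union> V2 \<union> V3" and disj: "V1 \<inter> V2 = {}" "V1 \<inter> V3 = {}" "V2 \<inter> V3 = {}"
    and ind: "independent_set V E V1" "independent_set V E V2" "independent_set V E V3"
    and big: "3 \<le> card V1" "3 \<le> card V2" and V3: "card V3 = 1"
    and mem: "x1 \<in> V1" "x3 \<in> V3" "y1 \<in> V2" "y2 \<in> V1" "y3 \<in> V2"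
    and x1y3: "{x1, y3} \<notin> E"
    and x3: "{x3, y1} \<notin> E" "{x3, y2} \<notin> E" "{x3, y3} \<in> E"
    and y1: "\<forall>v\<in>V1. {y1, v} \<in> E" and y2: "\<forall>w\<in>V2. {y2, w} \<in> E"
    and x1x3: "{x1, x3} \<in> E"
    and full: "\<forall>v\<in>V1 - {x1, y2}. (\<forall>w\<in>V2. {v, w} \<in> E) \<noteq> (\<forall>z\<in>V3. {v, z} \<in> E)"
      "\<forall>w\<in>V2 - {y3, y1}. (\<forall>v\<in>V1. {w, v} \<in> E) \<noteq> (\<forall>z\<in>V3. {w, z} \<in> E)"
    and card: "2 \<le> card {v \<in> V1. {x3, v} \<notin> E}" "2 \<le> card {w \<in> V2. {x3, w} \<notin> E}"
    and nonadj: "\<forall>x\<in>V1. \<forall>y\<in>V2. {x, y} \<notin> E \<longrightarrow>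
      (\<exists>w\<in>V2 - {y}. {x, w} \<notin> E) \<or> (\<exists>v\<in>V1 - {x}. {y, v} \<notin> E)"
    using assms(2) unfolding class_D3_def by (elim exE conjE) (rule that)
  have V3: "V3 = {x3}" using V3 mem(2) by (auto simp: card_1_singleton_iff)
  have ne: "x3 \<noteq> y1" "x3 \<noteq> y2" "y1 \<noteq> y2" using mem disj by auto
  \<comment> \<open>Extends (d) to the two exceptional vertices: \<open>x1\<close> is adjacent to
    \<open>x3\<close> and misses \<open>y3\<close>, while \<open>y2\<close> is joined to all of
    \<open>V2\<close> and misses \<open>x3\<close>.\<close>
  have E1: "(\<forall>w\<in>V2. {v, w} \<in> E) \<noteq> ({x3, v} \<in> E)" if v: "v \<in> V1" for v
  proof -
    consider "v = x1" | "v = y2" | "v \<in> V1 - {x1, y2}" using v by blast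
    then show ?thesis
    proof cases
      case 1
      then show ?thesis using x1y3 x1x3 mem by (auto simp: insert_commute)
    next
      case 2
      then show ?thesis using y2 x3 by simp
    next
      case 3
      then have "(\<forall>w\<in>V2. {v, w} \<in> E) \<noteq> ({v, x3} \<in> E)" using full(1) V3 by simp
      then show ?thesis by (simp add: insert_commute)
    qed
  qed
  have E2: "(\<forall>v\<in>V1. {w, v} \<in> E) \<noteq> ({x3, w} \<in> E)" if w: "w \<in> V2" for w
  proof -
    consider "w = y3" | "w = y1" | "w \<in> V2 - {y3, y1}" using w by blast
    then show ?thesis
    proof cases
      case 1
      then show ?thesis using x1y3 x3 mem by (auto simp: insert_commute)
    next
      case 2
      then show ?thesis using y1 x3 by simp
    next
      case 3
      then have "(\<forall>v\<in>V1. {w, v} \<in> E) \<noteq> ({w, x3} \<in> E)" using full(2) V3 by simp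
      then show ?thesis by (simp add: insert_commute)
    qed
  qed
  let ?C = "{V1, V2, {x3}}"
  have part: "partition_on V ?C"
    using V V3 disj mem by (auto simp: partition_on_def disjoint_def)
  then have col: "coloring V E ?C" using ind V3 by (simp add: coloring_def)
  moreover have "{v} \<in> ?C \<or> (\<exists>X\<in>?C. \<forall>u\<in>X. {v, u} \<in> E)" if v: "v \<in> V" for v
  proof -
    consider "v \<in> V1" | "v \<in> V2" | "v = x3" using v V V3 by blast
    then show ?thesis
    proof cases
      case 1
      then show ?thesis using E1[of v] by (auto simp: insert_commute)
    next
      case 2
      then show ?thesis using E2[of v] by (auto simp: insert_commute)
    qed simp
  qed
  ultimately have dcol: "dominator_coloring V E ?C" by (simp add: dominator_coloring_def)
  have "V1 \<noteq> V2" "V1 \<noteq> {x3}" "V2 \<noteq> {x3}" using disj V3 mem by auto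
  then have cardC: "card ?C = 3" by simp
  have chromatic: "3 \<le> card C" if "coloring V E C" for C
  proof (rule five_cycle_coloring_card[OF fin(1) that])
    show "{x1, x3, y3, y2, y1} \<subseteq> V" using mem V by blast
    show "{x1, x3} \<in> E" "{x3, y3} \<in> E" using x1x3 x3 by auto
    show "{y3, y2} \<in> E" using y2 mem by (auto simp: insert_commute)
    show "{y2, y1} \<in> E" using y2 mem by auto
    show "{y1, x1} \<in> E" using y1 mem by auto
  qed
  have dom: "dominating_set V E {x3, y1, y2}"
    using V V3 mem y1 y2 unfolding dominating_set_def by blast
  have another: "\<exists>v\<in>X. v \<noteq> s \<and> v \<noteq> t" if "3 \<le> card X" for X and s t :: 'a
  proof (rule ccontr)
    assume "\<not> ?thesis"
    then have "card X \<le> card {s, t}" by (intro card_mono) auto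
    then show False using that by (simp add: card_insert_if split: if_splits)
  qed
  have another': "\<exists>v\<in>X. v \<noteq> s" if "2 \<le> card X" for X and s :: 'a
  proof (rule ccontr)
    assume "\<not> ?thesis"
    then have "card X \<le> card {s}" by (intro card_mono) auto
    then show False using that by simp
  qed
  \<comment> \<open>\<open>free s t\<close> means that \<open>s\<close> and \<open>t\<close>
    together do not dominate; the cases follow the classes of the two vertices.\<close>
  define free where "free s t \<longleftrightarrow> (\<exists>v\<in>V. v \<noteq> s \<and> v \<noteq> t \<and> {s, v} \<notin> E \<and> {t, v} \<notin> E)" for s t
  have free_commute: "free t s" if "free s t" for s t using that unfolding free_def by blast
  have same: "free s t" if "3 \<le> card X" "X \<in> {V1, V2}" "s \<in> X" "t \<in> X" for X s t
    using another[OF that(1), of s t] that(2-4) ind V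
    unfolding free_def independent_set_def by blast
  \<comment> \<open>Of two non-neighbors of \<open>x3\<close> in the class of \<open>s\<close>, one
    differs from \<open>s\<close>, and independence of the class keeps it away from \<open>s\<close>
    too.\<close>
  have centre: "free s x3" if s: "s \<in> V1 \<union> V2 \<union> {x3}" for s
  proof -
    let ?A = "{v \<in> V1. {x3, v} \<notin> E}" and ?B = "{w \<in> V2. {x3, w} \<notin> E}"
    obtain a where a: "a \<in> ?A" "a \<noteq> s" using another'[OF card(1)] by blast
    obtain b where b: "b \<in> ?B" "b \<noteq> s" using another'[OF card(2)] by blast
    have "a \<noteq> x3" "b \<noteq> x3" using a b disj mem by auto
    consider "s \<in> V1" | "s \<in> V2" | "s = x3" using s by blast
    then show ?thesis
    proof cases
      case 1
      then have "{s, a} \<notin> E" using a ind(1) unfolding independent_set_def by blast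
      then show ?thesis using a \<open>a \<noteq> x3\<close> V unfolding free_def by blast
    next
      case 2
      then have "{s, b} \<notin> E" using b ind(2) unfolding independent_set_def by blast
      then show ?thesis using b \<open>b \<noteq> x3\<close> V unfolding free_def by blast
    next
      case 3
      then show ?thesis using a V unfolding free_def by blast
    qed
  qed
  \<comment> \<open>For non-adjacent \<open>s\<close> and \<open>t\<close> the vertex left over is
    the one given by (e).\<close>
  have across: "free s t" if st: "s \<in> V1" "t \<in> V2" for s t
  proof (cases "{s, t} \<in> E")
    case False
    then consider w where "w \<in> V2 - {t}" "{s, w} \<notin> E" | v where "v \<in> V1 - {s}" "{t, v} \<notin> E"
      using nonadj st by blast
    then show ?thesis
    proof cases
      case 1
      then have "{t, w} \<notin> E" "w \<noteq> s" using ind(2) st disj unfolding independent_set_def by blast+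
      then show ?thesis using 1 V unfolding free_def by blast
    next
      case 2
      then have "{s, v} \<notin> E" "v \<noteq> t" using ind(1) st disj unfolding independent_set_def by blast+
      then show ?thesis using 2 V unfolding free_def by blast
    qed
  next
    case True
    \<comment> \<open>If \<open>s\<close> is adjacent to \<open>x3\<close>, it misses some
      \<open>w\<close> in \<open>V2\<close>; this differs from its neighbor \<open>t\<close>, and
      \<open>t\<close> misses it by independence. The case of \<open>t\<close> is symmetric, and if
      both miss \<open>x3\<close>, then \<open>x3\<close> itself is left over.\<close>
    consider "{x3, s} \<in> E" | "{x3, t} \<in> E" | "{x3, s} \<notin> E" "{x3, t} \<notin> E" by blast
    then show ?thesis
    proof cases
      case 1
      then obtain w where w: "w \<in> V2" "{s, w} \<notin> E" using E1 st by blast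
      then have "w \<noteq> t" "w \<noteq> s" "{t, w} \<notin> E"
        using True ind(2) st disj unfolding independent_set_def by blast+
      then show ?thesis using w V unfolding free_def by blast
    next
      case 2
      then obtain v where v: "v \<in> V1" "{t, v} \<notin> E" using E2 st by blast
      moreover have "{t, s} \<in> E" using True by (simp add: insert_commute)
      ultimately have "v \<noteq> s" "v \<noteq> t" "{s, v} \<notin> E"
        using ind(1) st disj unfolding independent_set_def by auto
      then show ?thesis using v V unfolding free_def by blast
    next
      case 3
      then have "{s, x3} \<notin> E" "{t, x3} \<notin> E" by (simp_all add: insert_commute)
      moreover have "x3 \<noteq> s" "x3 \<noteq> t" using st disj mem by auto
      ultimately show ?thesis using V V3 unfolding free_def by blast
    qed
  qed
  have "free s t" if "s \<in> V" "t \<in> V" for s t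
  proof -
    have s: "s \<in> V1 \<union> V2 \<union> {x3}" and t: "t \<in> V1 \<union> V2 \<union> {x3}" using that V V3 by auto
    then consider "s = x3" | "t = x3" | "s \<in> V1" "t \<in> V1" | "s \<in> V2" "t \<in> V2"
      | "s \<in> V1" "t \<in> V2" | "s \<in> V2" "t \<in> V1" by blast
    then show ?thesis
    proof cases
      case 1
      then show ?thesis using centre[OF t] free_commute by simp
    next
      case 2
      then show ?thesis using centre[OF s] by simp
    next
      case 3
      then show ?thesis using same[OF big(1)] by simp
    next
      case 4
      then show ?thesis using same[OF big(2)] by simp
    next
      case 5
      then show ?thesis by (rule across)
    next
      case 6
      then show ?thesis by (intro free_commute[OF across])
    qed
  qed
  then have "\<forall>S. dominating_set V E S \<longrightarrow> 3 \<le> card S"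
    unfolding dominating_set_card_ge_3_iff[OF fin] free_def by blast
  moreover have "card {x3, y1, y2} = 3" using ne by simp
  ultimately show ?thesis
    unfolding D_graph_iff[OF graph] using dom dcol cardC chromatic by blast
qed

theorem theorem3:
  fixes V :: "'a set" and E :: "'a set set"
  assumes "simple_graph V E" and "connected_graph V E"
  shows "(D_graph 3 V E \<longleftrightarrow> class_D3 V E) \<and> \<not> (D_graph 3 V E \<and> planar_graph V E)"
  using D_graph_imp_class_D3 class_D3_imp_D_graph class_D3_not_planar assms(1) by blast

end
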